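(* Let $f\colon K\to L$ be a non-degenerate simplicial map between finite simplicial complexes. Then the piecewise linear map $|f|\colon|K|\to|L|$ lifts to an embedding if and only if there exists an admissible collection of linear orders on the sets $K_v$, $v\in V(L)$. Furthermore, there exists a bijection between the admissible collections of linear orders and the isotopy classes of liftings of $|f|$.
   Context: $|K|$ denotes the geometric realisation of $K$, $V(K)$ its set of vertices, and $|f|$ the piecewise linear map induced by a simplicial map $f$. A simplicial map $f$ between finite complexes is non-degenerate if it is injective on each simplex (equivalently, $|f|$ has finite point preimages). A piecewise linear map $\varphi\colon P\to Q$ of polyhedra lifts to an embedding if there is a piecewise linear embedding $\widetilde{\varphi}\colon P\to Q\times\mathbb{R}$ with $\varphi=\mathrm{pr}_Q\circ\widetilde{\varphi}$; such $\widetilde\varphi$ is called a lifting of $\varphi$. Two liftings are isotopic if they are connected by an isotopy through liftings, i.e. a continuous map $F\colon P\times[0,1]\to Q\times\mathbb{R}$ such that each $F(\cdot,t)$ is a lifting of $\varphi$ and $F(\cdot,0)$, $F(\cdot,1)$ are the given liftings. For each simplex $C\in L$, let $K_C$ be the set of simplices of $K$ mapped onto $C$ by $f$; in particular $K_v=f^{-1}(v)$ for $v\in V(L)$. A collection $\{(\prec_v,K_v)\}_{v\in V(L)}$ of (strict) linear orders on the sets $K_v$ is called admissible if it induces linear orders on all the sets $K_C$, $C\in L$, in the following sense: for every $C\in L$ and every pair of simplices $A,B\in K_C$, letting $V_f(A,B)\subset V(A)\times V(B)$ be the set of all pairs $(v,w)$ with $f(v)=f(w)$, either $v\preceq_{f(v)}w$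 for all $(v,w)\in V_f(A,B)$, or $v\succeq_{f(v)}w$ for all $(v,w)\in V_f(A,B)$. *)

theory Defs
  imports "HOL-Analysis.Analysis"
begin

section \<open>Finite simplicial complexes and simplicial maps\<close>

text \<open>A complex is given abstractly: a simplex is its nonempty set of vertices, so
  \<open>V(A) = A\<close> and \<open>V(K) = \<Union>K\<close>. A simplicial map is given by its vertex map, whose values
  outside \<open>\<Union>K\<close> are irrelevant.\<close>

definition finite_complex :: "'v set set \<Rightarrow> bool" where
  "finite_complex K \<longleftrightarrow> finite K \<and> (\<forall>A\<in>K. finite A \<and> A \<noteq> {}) \<and>
     (\<forall>A\<in>K. \<forall>B. B \<subseteq> A \<and> B \<noteq> {} \<longrightarrow> B \<in> K)"

definition simplicial_map :: "'v set set \<Rightarrow> 'w set set \<Rightarrow> ('v \<Rightarrow> 'w) \<Rightarrow> bool" where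
  "simplicial_map K L f \<longleftrightarrow> (\<forall>A\<in>K. f ` A \<in> L)"

definition nondegenerate :: "'v set set \<Rightarrow> ('v \<Rightarrow> 'w) \<Rightarrow> bool" where
  "nondegenerate K f \<longleftrightarrow> (\<forall>A\<in>K. inj_on f A)"

text \<open>Points of the geometric realisation are given by their barycentric coordinates. The vertex
  type is finite, so that the realisation is a subset of a Euclidean space; it may contain
  elements that are not vertices of \<open>K\<close>.\<close>

definition realisation :: "'v::finite set set \<Rightarrow> (real^'v) set" where
  "realisation K = {x. (\<forall>v. 0 \<le> x $ v) \<and> (\<Sum>v\<in>UNIV. x $ v) = 1 \<and> {v. x $ v \<noteq> 0} \<in> K}"

definition realisation_map :: "'v::finite set set \<Rightarrow> ('v \<Rightarrow> 'w::finite) \<Rightarrow> real^'v \<Rightarrow> real^'w" where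
  "realisation_map K f x = (\<chi> w. \<Sum>v | v \<in> \<Union>K \<and> f v = w. x $ v)"

section \<open>Piecewise linear maps, liftings and isotopy\<close>

definition affine_map_on :: "'a::real_vector set \<Rightarrow> ('a \<Rightarrow> 'b::real_vector) \<Rightarrow> bool" where
  "affine_map_on S g \<longleftrightarrow> (\<exists>h c. linear h \<and> (\<forall>x\<in>S. g x = h x + c))"

text \<open>Piecewise linear maps on a compact polyhedron \<open>P\<close>; continuity is automatic, since a
  triangulation is a finite family of closed sets.\<close>

definition pl_map :: "'a::euclidean_space set \<Rightarrow> 'b::euclidean_space set \<Rightarrow> ('a \<Rightarrow> 'b) \<Rightarrow> bool" where
  "pl_map P Q g \<longleftrightarrow> g ` P \<subseteq> Q \<and>
     (\<exists>\<T>. triangulation \<T> \<and> \<Union>\<T> = P \<and> (\<forall>S\<in>\<T>. affine_map_on S g))"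

definition pl_embedding :: "'a::euclidean_space set \<Rightarrow> 'b::euclidean_space set \<Rightarrow> ('a \<Rightarrow> 'b) \<Rightarrow> bool" where
  "pl_embedding P Q g \<longleftrightarrow> pl_map P Q g \<and> embedding_map (top_of_set P) (top_of_set Q) g"

definition is_lifting :: "'a::euclidean_space set \<Rightarrow> 'b::euclidean_space set \<Rightarrow> ('a \<Rightarrow> 'b) \<Rightarrow>
    ('a \<Rightarrow> 'b \<times> real) \<Rightarrow> bool" where
  "is_lifting P Q \<phi> g \<longleftrightarrow> pl_embedding P (Q \<times> UNIV) g \<and> (\<forall>x\<in>P. fst (g x) = \<phi> x)"

definition lifts_to_embedding :: "'a::euclidean_space set \<Rightarrow> 'b::euclidean_space set \<Rightarrow> ('a \<Rightarrow> 'b) \<Rightarrow> bool" where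
  "lifts_to_embedding P Q \<phi> \<longleftrightarrow> (\<exists>g. is_lifting P Q \<phi> g)"

definition isotopic_liftings :: "'a::euclidean_space set \<Rightarrow> 'b::euclidean_space set \<Rightarrow> ('a \<Rightarrow> 'b) \<Rightarrow>
    ('a \<Rightarrow> 'b \<times> real) \<Rightarrow> ('a \<Rightarrow> 'b \<times> real) \<Rightarrow> bool" where
  "isotopic_liftings P Q \<phi> g h \<longleftrightarrow>
     homotopic_with_canon (is_lifting P Q \<phi>) P (Q \<times> UNIV) g h"

text \<open>Liftings are total functions here; two that agree on \<open>P\<close> are isotopic, so the values
  outside \<open>P\<close> do not affect the set of classes.\<close>

definition isotopy_classes :: "'a::euclidean_space set \<Rightarrow> 'b::euclidean_space set \<Rightarrow> ('a \<Rightarrow> 'b) \<Rightarrow>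
    ('a \<Rightarrow> 'b \<times> real) set set" where
  "isotopy_classes P Q \<phi> = {g. is_lifting P Q \<phi> g} // {(g, h). isotopic_liftings P Q \<phi> g h}"

section \<open>Admissible collections of linear orders\<close>

definition simplices_over :: "'v set set \<Rightarrow> ('v \<Rightarrow> 'w) \<Rightarrow> 'w set \<Rightarrow> 'v set set" where
  "simplices_over K f C = {A \<in> K. f ` A = C}"

definition vertices_over :: "'v set set \<Rightarrow> ('v \<Rightarrow> 'w) \<Rightarrow> 'w \<Rightarrow> 'v set" where
  "vertices_over K f w = {v \<in> \<Union>K. f v = w}"

definition vertex_pairs :: "('v \<Rightarrow> 'w) \<Rightarrow> 'v set \<Rightarrow> 'v set \<Rightarrow> ('v \<times> 'v) set" where
  "vertex_pairs f A B = {(v, w) \<in> A \<times> B. f v = f w}"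

text \<open>\<open>(v, w) \<in> R u\<close> means that \<open>v\<close> strictly precedes \<open>w\<close> in the order on \<open>K\<^sub>u\<close>. As
  \<^const>\<open>strict_linear_order_on\<close> does not confine the relation to its carrier, and the values of
  \<open>R\<close> outside \<open>V(L)\<close> carry no meaning, both are pinned down, so that different \<open>R\<close> are
  different collections.\<close>

definition order_collections :: "'v set set \<Rightarrow> 'w set set \<Rightarrow> ('v \<Rightarrow> 'w) \<Rightarrow> ('w \<Rightarrow> 'v rel) set" where
  "order_collections K L f = (\<Pi>\<^sub>E u\<in>\<Union>L.
     {r. r \<subseteq> vertices_over K f u \<times> vertices_over K f u \<and>
         strict_linear_order_on (vertices_over K f u) r})"

definition admissible :: "'v set set \<Rightarrow> 'w set set \<Rightarrow> ('v \<Rightarrow> 'w) \<Rightarrow> ('w \<Rightarrow> 'v rel) \<Rightarrow> bool" where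
  "admissible K L f R \<longleftrightarrow> R \<in> order_collections K L f \<and>
     (\<forall>C\<in>L. \<forall>A\<in>simplices_over K f C. \<forall>B\<in>simplices_over K f C.
        (\<forall>(v, w)\<in>vertex_pairs f A B. v = w \<or> (v, w) \<in> R (f v)) \<or>
        (\<forall>(v, w)\<in>vertex_pairs f A B. v = w \<or> (w, v) \<in> R (f v)))"

end

theory Submission
  imports Defs
begin

text \<open>Call the \<open>\<real>\<close>-coordinate of a lifting the height. Two distinct points with the same image have
  distinct heights, so a lifting orders every fibre of \<open>|f|\<close>, in particular the vertices over each
  vertex of \<open>L\<close>. The theorem says that these vertex orders are always admissible, that they
  determine the lifting up to isotopy, and that every admissible collection arises in this way.

  All of this rests on one comparison (\<open>lifting_order_by_vertices\<close>). Let \<open>x\<close> and \<open>y\<close> have the same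
  image, and let \<open>v \<noteq> w\<close> be vertices of their carriers with \<open>f v = f w\<close>. As \<open>x\<close> moves straight to \<open>v\<close>
  and \<open>y\<close> straight to \<open>w\<close>, their images stay equal and the points stay distinct, so the
  difference of the heights never vanishes and keeps its sign: \<open>x\<close> is below \<open>y\<close> iff \<open>v\<close> is below \<open>w\<close>.

  Applied to the barycentres of two simplices over \<open>C\<close>, this says that all pairs of distinct matching
  vertices are ordered alike, which is admissibility (\<open>admissible_vertex_orders\<close>). Applied to two
  liftings with the same vertex orders, it says that both order every fibre of \<open>|f|\<close> in the same
  way, so each map on the straight line between them is injective, and this line is an isotopy
  (\<open>isotopic_liftings_if_same_order\<close>); it is piecewise linear at each time because two triangulations
  of a polyhedron have a common refinement. Conversely, during an isotopy the heights of two points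
  with the same image never coincide, so the vertex orders do not change
  (\<open>isotopic_liftings_imp_same_order\<close>). Finally, given an admissible collection, place each vertex at
  the number of its predecessors and extend linearly over the simplices; the difference of the heights
  of two points with the same image is a positive combination of differences at matching vertices,
  no two of which have opposite signs, so it vanishes only if the points are equal
  (\<open>lifting_of_admissible\<close>).\<close>

section \<open>Piecewise linear maps and liftings\<close>

lemma affine_map_on_subset: "affine_map_on S g \<Longrightarrow> T \<subseteq> S \<Longrightarrow> affine_map_on T g"
  unfolding affine_map_on_def by blast

lemma affine_map_on_linear_combination:
  assumes "affine_map_on S g" "affine_map_on S h"
  shows "affine_map_on S (\<lambda>x. a *\<^sub>R g x + b *\<^sub>R h x)"
proof -
  obtain g' c where g: "linear g'" "\<forall>x\<in>S. g x = g' x + c"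
    using assms(1) unfolding affine_map_on_def by blast
  obtain h' d where h: "linear h'" "\<forall>x\<in>S. h x = h' x + d"
    using assms(2) unfolding affine_map_on_def by blast
  have "linear (\<lambda>x. a *\<^sub>R g' x + b *\<^sub>R h' x)"
    using g(1) h(1) by (intro linear_compose_add linear_compose_scale_right)
  moreover have "\<forall>x\<in>S. a *\<^sub>R g x + b *\<^sub>R h x = (a *\<^sub>R g' x + b *\<^sub>R h' x) + (a *\<^sub>R c + b *\<^sub>R d)"
    using g(2) h(2) by (simp add: algebra_simps)
  ultimately show ?thesis
    unfolding affine_map_on_def by blast
qed

text \<open>The pairwise intersections of simplices of the two triangulations form a cell complex of
  polytopes. Subdividing it into simplices without moving its underlying set gives a
  triangulation inscribed in both.\<close>

lemma common_refinement_of_triangulations: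
  fixes \<S> \<T> :: "'a::euclidean_space set set"
  assumes "triangulation \<S>" "triangulation \<T>" "\<Union>\<S> = \<Union>\<T>"
  obtains \<U> where "triangulation \<U>" "\<Union>\<U> = \<Union>\<S>"
    "\<And>U. U \<in> \<U> \<Longrightarrow> \<exists>S\<in>\<S>. \<exists>T\<in>\<T>. U \<subseteq> S \<inter> T"
proof -
  define \<M> where "\<M> = (\<lambda>(S, T). S \<inter> T) ` (\<S> \<times> \<T>)"
  have fin: "finite \<M>"
    using assms unfolding \<M>_def triangulation_def by blast
  have poly: "polytope C" if "C \<in> \<M>" for C
    using that assms unfolding \<M>_def triangulation_def
    by (auto intro!: polytope_Int dest: simplex_imp_polytope)
  have face: "C1 \<inter> C2 face_of C1" if C: "C1 \<in> \<M>" "C2 \<in> \<M>" for C1 C2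
  proof -
    obtain S1 T1 S2 T2 where *: "S1 \<in> \<S>" "T1 \<in> \<T>" "C1 = S1 \<inter> T1" "S2 \<in> \<S>" "T2 \<in> \<T>" "C2 = S2 \<inter> T2"
      using C unfolding \<M>_def by auto
    have "(S1 \<inter> S2) \<inter> (T1 \<inter> T2) face_of S1 \<inter> T1"
      using assms * unfolding triangulation_def by (intro face_of_Int_Int) auto
    moreover have "(S1 \<inter> S2) \<inter> (T1 \<inter> T2) = C1 \<inter> C2"
      using * by blast
    ultimately show ?thesis
      using * by simp
  qed
  obtain \<U> where U: "simplicial_complex \<U>" "\<Union>\<U> = \<Union>\<M>" "\<And>U. U \<in> \<U> \<Longrightarrow> \<exists>C. C \<in> \<M> \<and> U \<subseteq> C"
    using simplicial_subdivision_of_cell_complex[OF fin poly face] by metis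
  show thesis
  proof
    show "triangulation \<U>"
      using U(1) unfolding simplicial_complex_def triangulation_def by blast
    have "\<Union>\<M> = \<Union>\<S> \<inter> \<Union>\<T>"
      unfolding \<M>_def by blast
    then show "\<Union>\<U> = \<Union>\<S>"
      using U(2) assms(3) by simp
    show "\<exists>S\<in>\<S>. \<exists>T\<in>\<T>. U \<subseteq> S \<inter> T" if "U \<in> \<U>" for U
      using U(3)[OF that] unfolding \<M>_def by auto
  qed
qed

lemma pl_map_linear_combination:
  assumes g: "pl_map P Q g" and h: "pl_map P Q' h"
    and im: "\<And>x. x \<in> P \<Longrightarrow> a *\<^sub>R g x + b *\<^sub>R h x \<in> Q''"
  shows "pl_map P Q'' (\<lambda>x. a *\<^sub>R g x + b *\<^sub>R h x)"
proof -
  obtain \<S> where S: "triangulation \<S>" "\<Union>\<S> = P" "\<forall>S\<in>\<S>. affine_map_on S g"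
    using g unfolding pl_map_def by blast
  obtain \<T> where T: "triangulation \<T>" "\<Union>\<T> = P" "\<forall>S\<in>\<T>. affine_map_on S h"
    using h unfolding pl_map_def by blast
  obtain \<U> where U: "triangulation \<U>" "\<Union>\<U> = \<Union>\<S>"
    "\<And>U. U \<in> \<U> \<Longrightarrow> \<exists>S\<in>\<S>. \<exists>T\<in>\<T>. U \<subseteq> S \<inter> T"
    using common_refinement_of_triangulations[OF S(1) T(1)] S(2) T(2) by metis
  have "affine_map_on U (\<lambda>x. a *\<^sub>R g x + b *\<^sub>R h x)" if UU: "U \<in> \<U>" for U
  proof -
    obtain S' T' where "S' \<in> \<S>" "T' \<in> \<T>" "U \<subseteq> S'" "U \<subseteq> T'"
      using U(3)[OF UU] by blast
    then show ?thesis
      using S(3) T(3) by (intro affine_map_on_linear_combination) (blast intro: affine_map_on_subset)+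
  qed
  then show ?thesis
    using U S(2) im unfolding pl_map_def by blast
qed

lemma compact_pl_map_domain:
  assumes "pl_map P Q g"
  shows "compact P"
proof -
  obtain \<T> where "triangulation \<T>" "\<Union>\<T> = P"
    using assms unfolding pl_map_def by blast
  then show ?thesis
    unfolding triangulation_def using compact_Union compact_simplex by metis
qed

text \<open>A continuous injection of a compact space into a Hausdorff space is an embedding.\<close>

lemma is_lifting_iff:
  "is_lifting P Q \<phi> g \<longleftrightarrow>
     pl_map P (Q \<times> UNIV) g \<and> continuous_on P g \<and> inj_on g P \<and> (\<forall>x\<in>P. fst (g x) = \<phi> x)"
proof -
  have "embedding_map (top_of_set P) (top_of_set (Q \<times> UNIV)) g \<longleftrightarrow> continuous_on P g \<and> inj_on g P"
    if pl: "pl_map P (Q \<times> UNIV) g"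
  proof
    assume "embedding_map (top_of_set P) (top_of_set (Q \<times> UNIV)) g"
    then have "homeomorphic_map (top_of_set P)
        (subtopology (top_of_set (Q \<times> UNIV)) (g ` topspace (top_of_set P))) g"
      unfolding embedding_map_def .
    then show "continuous_on P g \<and> inj_on g P"
      unfolding homeomorphic_eq_everything_map
      by (auto simp: subtopology_subtopology)
  next
    assume *: "continuous_on P g \<and> inj_on g P"
    have im: "g ` P \<subseteq> Q \<times> UNIV"
      using pl unfolding pl_map_def by blast
    have "continuous_map (top_of_set P) (top_of_set (Q \<times> UNIV)) g"
      using * im by auto
    moreover from this have "closed_map (top_of_set P) (top_of_set (Q \<times> UNIV)) g"
      using compact_pl_map_domain[OF pl]
      by (intro continuous_imp_closed_map)
         (auto simp: compact_space_subtopology Hausdorff_space_subtopology)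
    ultimately show "embedding_map (top_of_set P) (top_of_set (Q \<times> UNIV)) g"
      using * by (intro injective_closed_imp_embedding_map) auto
  qed
  then show ?thesis
    unfolding is_lifting_def pl_embedding_def by blast
qed

text \<open>The straight line between two liftings moves points only in the direction of \<open>\<real>\<close>, so
  injectivity is the one property of the intermediate maps that can fail. The heights of two points
  with the same image are mixed in the same proportion, and this preserves a strict inequality
  that holds for both liftings.\<close>

lemma isotopic_liftings_if_same_order:
  assumes g: "is_lifting P Q \<phi> g" and h: "is_lifting P Q \<phi> h"
    and same: "\<And>x y. x \<in> P \<Longrightarrow> y \<in> P \<Longrightarrow> \<phi> x = \<phi> y \<Longrightarrow>
        snd (g x) < snd (g y) \<longleftrightarrow> snd (h x) < snd (h y)"
  shows "isotopic_liftings P Q \<phi> g h"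
proof -
  define F where "F = (\<lambda>(t::real, x). (1 - t) *\<^sub>R g x + t *\<^sub>R h x)"
  note g' = g[unfolded is_lifting_iff] and h' = h[unfolded is_lifting_iff]
  have fstF: "fst (F (t, x)) = \<phi> x" if "x \<in> P" for t x
    using that g' h' by (simp add: F_def flip: scaleR_left_distrib)
  have imF: "F (t, x) \<in> Q \<times> UNIV" if "x \<in> P" for t x
  proof -
    have "\<phi> x \<in> Q"
      using g' that unfolding pl_map_def by fastforce
    then show ?thesis
      using fstF[OF that, of t] by (cases "F (t, x)") auto
  qed
  have contF: "continuous_on ({0..1} \<times> P) F"
    unfolding F_def case_prod_unfold using g' h'
    by (intro continuous_intros) (auto intro: continuous_on_compose2[OF _ continuous_on_snd])
  have lift: "is_lifting P Q \<phi> (\<lambda>x. F (t, x))" if t: "t \<in> {0..1}" for t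
    unfolding is_lifting_iff
  proof (intro conjI ballI)
    show "pl_map P (Q \<times> UNIV) (\<lambda>x. F (t, x))"
      using g' h' imF[of _ t] unfolding F_def prod.case
      by (blast intro: pl_map_linear_combination)
    show "continuous_on P (\<lambda>x. F (t, x))"
      unfolding F_def using g' h' by (auto intro!: continuous_intros)
    show "fst (F (t, x)) = \<phi> x" if "x \<in> P" for x
      using fstF[OF that] .
    have *: "F (t, x) \<noteq> F (t, y)"
      if xy: "x \<in> P" "y \<in> P" "\<phi> x = \<phi> y" and less: "snd (g x) < snd (g y)" for x y
    proof -
      have "snd (h x) < snd (h y)"
        using same[OF xy] less by simp
      then have "(1 - t) * snd (g x) + t * snd (h x) < (1 - t) * snd (g y) + t * snd (h y)"
        using less t by (cases "t = 1") (auto intro!: add_less_le_mono mult_left_mono)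
      then show ?thesis
        unfolding F_def by (auto simp: prod_eq_iff)
    qed
    show "inj_on (\<lambda>x. F (t, x)) P"
    proof (rule inj_onI, rule ccontr)
      fix x y assume xy: "x \<in> P" "y \<in> P" "F (t, x) = F (t, y)" "x \<noteq> y"
      then have "\<phi> x = \<phi> y"
        using fstF by metis
      moreover have "g x \<noteq> g y"
        using g' xy by (auto dest: inj_onD)
      ultimately have "snd (g x) < snd (g y) \<or> snd (g y) < snd (g x)"
        using g' xy by (auto simp: prod_eq_iff)
      then show False
        using *[of x y] *[of y x] xy \<open>\<phi> x = \<phi> y\<close> by metis
    qed
  qed
  have "continuous_map (prod_topology (top_of_set {0..1}) (top_of_set P)) (top_of_set (Q \<times> UNIV)) F"
    using contF imF by (auto simp: prod_topology_subtopology_eu)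
  moreover have "F (0, x) = g x" "F (1, x) = h x" for x
    unfolding F_def by simp_all
  ultimately show ?thesis
    using lift unfolding isotopic_liftings_def homotopic_with_def by blast
qed

lemma continuous_less_constant:
  fixes a b :: "real \<Rightarrow> real"
  assumes "continuous_on {0..1} a" "continuous_on {0..1} b"
    and "\<And>t. t \<in> {0..1} \<Longrightarrow> a t \<noteq> b t"
  shows "a 0 < b 0 \<longleftrightarrow> a 1 < b 1"
proof -
  define d where "d = (\<lambda>t. b t - a t)"
  have "continuous_on {0..1} d"
    unfolding d_def using assms by (intro continuous_intros)
  then have "connected (d ` {0..1})"
    by (intro connected_continuous_image) auto
  moreover have "0 \<notin> d ` {0..1}"
    using assms(3) unfolding d_def by fastforce
  moreover have "d 0 \<in> d ` {0..1}" "d 1 \<in> d ` {0..1}"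
    by auto
  ultimately have "\<not> (d 0 \<le> 0 \<and> 0 \<le> d 1)" "\<not> (d 1 \<le> 0 \<and> 0 \<le> d 0)"
    unfolding connected_iff_interval by blast+
  then show ?thesis
    unfolding d_def by linarith
qed

lemma lifting_heights_distinct:
  assumes "is_lifting P Q \<phi> g" "x \<in> P" "y \<in> P" "\<phi> x = \<phi> y" "x \<noteq> y"
  shows "snd (g x) \<noteq> snd (g y)"
  using assms unfolding is_lifting_iff by (metis inj_onD prod_eqI)

text \<open>Two paths that stay distinct while having equal images never agree in height.\<close>

lemma lifting_order_constant_along_paths:
  assumes g: "is_lifting P Q \<phi> g"
    and cont: "continuous_on {0..1} p" "continuous_on {0..1} q"
    and pq: "\<And>t. t \<in> {0..1} \<Longrightarrow> p t \<in> P \<and> q t \<in> P \<and> \<phi> (p t) = \<phi> (q t) \<and> p t \<noteq> q t"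
  shows "snd (g (p 0)) < snd (g (q 0)) \<longleftrightarrow> snd (g (p 1)) < snd (g (q (1::real)))"
proof (rule continuous_less_constant)
  have "continuous_on P g"
    using g unfolding is_lifting_iff by blast
  then show "continuous_on {0..1} (\<lambda>t. snd (g (p t)))" "continuous_on {0..1} (\<lambda>t. snd (g (q t)))"
    using cont pq by (auto intro!: continuous_on_snd continuous_on_compose2[of P g])
  show "snd (g (p t)) \<noteq> snd (g (q t))" if "t \<in> {0..1}" for t
    using lifting_heights_distinct[OF g] pq[OF that] by blast
qed

lemma isotopic_liftings_imp_same_order:
  assumes iso: "isotopic_liftings P Q \<phi> g h"
    and xy: "x \<in> P" "y \<in> P" "\<phi> x = \<phi> y" "x \<noteq> y"
  shows "snd (g x) < snd (g y) \<longleftrightarrow> snd (h x) < snd (h y)"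
proof -
  (* The moving heights of x and y are continuous in time and differ at each time. *)
  obtain F where F: "continuous_map (prod_topology (top_of_set {0..1::real}) (top_of_set P))
        (top_of_set (Q \<times> UNIV)) F" "\<And>x. F (0, x) = g x" "\<And>x. F (1, x) = h x"
      "\<And>t. t \<in> {0..1} \<Longrightarrow> is_lifting P Q \<phi> (\<lambda>x. F (t, x))"
    using iso unfolding isotopic_liftings_def homotopic_with_def by blast
  have "continuous_on ({0..1} \<times> P) F"
    using F(1) by (simp add: prod_topology_subtopology_eu)
  then have cont: "continuous_on {0..1} (\<lambda>t. snd (F (t, z)))" if "z \<in> P" for z
  proof (rule continuous_on_snd[OF continuous_on_compose2])
    show "continuous_on {0..1} (\<lambda>t::real. (t, z))"
      by (intro continuous_intros)
  qed (use that in auto)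
  have "snd (F (0, x)) < snd (F (0, y)) \<longleftrightarrow> snd (F (1, x)) < snd (F (1, y))"
    using cont xy lifting_heights_distinct[OF F(4)] by (intro continuous_less_constant) auto
  then show ?thesis
    using F(2,3) by simp
qed

section \<open>Barycentric coordinates\<close>

lemma finite_complex_subset:
  "finite_complex K \<Longrightarrow> A \<in> K \<Longrightarrow> B \<subseteq> A \<Longrightarrow> B \<noteq> {} \<Longrightarrow> B \<in> K"
  unfolding finite_complex_def by blast

definition supp :: "real^'v \<Rightarrow> 'v::finite set" where
  "supp x = {v. x $ v \<noteq> 0}"

lemma mem_realisation_iff:
  "x \<in> realisation K \<longleftrightarrow> (\<forall>v. 0 \<le> x $ v) \<and> (\<Sum>v\<in>UNIV. x $ v) = 1 \<and> supp x \<in> K"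
  unfolding realisation_def supp_def by simp

lemma mem_simplex_iff:
  fixes A :: "'v::finite set"
  shows "x \<in> convex hull ((\<lambda>v. axis v (1::real)) ` A) \<longleftrightarrow>
    (\<forall>v. 0 \<le> x $ v) \<and> (\<Sum>v\<in>UNIV. x $ v) = 1 \<and> supp x \<subseteq> A" (is "_ \<longleftrightarrow> ?S x")
proof
  have "convex {x. ?S x}"
  proof (rule convexI)
    fix x y :: "real^'v" and a b :: real
    assume *: "x \<in> {x. ?S x}" "y \<in> {x. ?S x}" "0 \<le> a" "0 \<le> b" "a + b = 1"
    have "v \<notin> supp (a *\<^sub>R x + b *\<^sub>R y)" if "v \<notin> A" for v
    proof -
      have "x $ v = 0" "y $ v = 0"
        using * that unfolding supp_def by blast+
      then show ?thesis
        by (simp add: supp_def)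
    qed
    then have "supp (a *\<^sub>R x + b *\<^sub>R y) \<subseteq> A"
      by blast
    moreover have "(\<Sum>v\<in>UNIV. (a *\<^sub>R x + b *\<^sub>R y) $ v) = 1"
      using * by (simp add: sum.distrib flip: sum_distrib_left)
    ultimately show "a *\<^sub>R x + b *\<^sub>R y \<in> {x. ?S x}"
      using * by simp
  qed
  moreover have "(\<lambda>v. axis v 1) ` A \<subseteq> {x. ?S x}"
    by (auto simp: supp_def axis_def split: if_splits)
  ultimately show "x \<in> convex hull ((\<lambda>v. axis v 1) ` A) \<Longrightarrow> ?S x"
    using hull_minimal[of _ "{x. ?S x}" convex] by blast
next
  assume S: "?S x"
  have "(\<Sum>v\<in>UNIV. x $ v) = (\<Sum>v\<in>A. x $ v)"
    using S by (intro sum.mono_neutral_right) (auto simp: supp_def)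
  then have "(\<Sum>v\<in>A. x $ v *\<^sub>R axis v (1::real)) \<in> convex hull ((\<lambda>v. axis v 1) ` A)"
    using S by (intro convex_sum) (auto intro: hull_inc)
  moreover have "(\<Sum>v\<in>A. x $ v *\<^sub>R axis v (1::real)) = x"
  proof -
    have "(\<Sum>v\<in>A. x $ v *\<^sub>R axis v (1::real)) = (\<Sum>v\<in>UNIV. x $ v *\<^sub>R axis v (1::real))"
      using S by (intro sum.mono_neutral_left) (auto simp: supp_def)
    also have "\<dots> = x"
      using basis_expansion[of x] by (simp add: scalar_mult_eq_scaleR)
    finally show ?thesis .
  qed
  ultimately show "x \<in> convex hull ((\<lambda>v. axis v 1) ` A)"
    by simp
qed

lemma affine_independent_axes: "\<not> affine_dependent ((\<lambda>v. axis v (1::real)) ` A)"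
proof -
  have "(\<lambda>v. axis v (1::real)) ` A \<subseteq> Basis"
    by (auto simp: Basis_vec_def)
  then show ?thesis
    using independent_Basis independent_mono affine_dependent_imp_dependent by blast
qed

lemma realisation_triangulation:
  fixes K :: "'v::finite set set"
  assumes "finite_complex K"
  defines "\<T> \<equiv> (\<lambda>A. convex hull ((\<lambda>v. axis v (1::real)) ` A)) ` K"
  shows "triangulation \<T>" "\<Union>\<T> = realisation K"
proof -
  have "S \<inter> T face_of S" if ST: "S \<in> \<T>" "T \<in> \<T>" for S T
  proof -
    obtain A B where *: "S = convex hull ((\<lambda>v. axis v (1::real)) ` A)"
      "T = convex hull ((\<lambda>v. axis v (1::real)) ` B)"
      using ST unfolding \<T>_def by auto
    have "S \<inter> T = convex hull ((\<lambda>v. axis v (1::real)) ` (A \<inter> B))"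
      unfolding * by (auto simp only: mem_simplex_iff Int_iff)
    moreover have "convex hull ((\<lambda>v. axis v (1::real)) ` (A \<inter> B)) face_of S"
      unfolding *(1) face_of_convex_hull_affine_independent[OF affine_independent_axes]
      by (intro exI[of _ "(\<lambda>v. axis v (1::real)) ` (A \<inter> B)"]) auto
    ultimately show ?thesis
      by simp
  qed
  moreover have "\<exists>n. n simplex S" if S: "S \<in> \<T>" for S
  proof -
    obtain A where "S = convex hull ((\<lambda>v. axis v (1::real)) ` A)"
      using S unfolding \<T>_def by auto
    then have "(int (card ((\<lambda>v. axis v (1::real)) ` A)) - 1) simplex S"
      using affine_independent_axes[of A] by (auto intro: simplex_convex_hull)
    then show ?thesis ..
  qed
  moreover have "finite \<T>"
    using assms(1) unfolding \<T>_def finite_complex_def by blast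
  ultimately show "triangulation \<T>"
    unfolding triangulation_def by blast
  have "x \<in> \<Union>\<T> \<longleftrightarrow> x \<in> realisation K" for x
  proof -
    have "(\<exists>A\<in>K. supp x \<subseteq> A) \<longleftrightarrow> supp x \<in> K" if sum: "(\<Sum>v\<in>UNIV. x $ v) = 1"
    proof -
      have "supp x \<noteq> {}"
      proof
        assume "supp x = {}"
        then have "x $ v = 0" for v
          unfolding supp_def by blast
        then show False
          using sum by simp
      qed
      then show ?thesis
        using finite_complex_subset[OF assms(1)] by (meson order_refl)
    qed
    moreover have "x \<in> \<Union>\<T> \<longleftrightarrow>
        (\<exists>A\<in>K. (\<forall>v. 0 \<le> x $ v) \<and> (\<Sum>v\<in>UNIV. x $ v) = 1 \<and> supp x \<subseteq> A)"
      unfolding \<T>_def by (simp only: UN_iff mem_simplex_iff)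
    ultimately show ?thesis
      unfolding mem_realisation_iff by blast
  qed
  then show "\<Union>\<T> = realisation K"
    by blast
qed

lemma supp_axis [simp]: "supp (axis v 1) = {v}"
  unfolding supp_def axis_def by auto

lemma realisation_segment:
  fixes x y :: "real^'v::finite"
  assumes K: "finite_complex K" and x: "x \<in> realisation K"
    and y: "\<forall>v. 0 \<le> y $ v" "(\<Sum>v\<in>UNIV. y $ v) = 1" "supp y \<subseteq> supp x" and t: "t \<in> {0..1}"
  shows "(1 - t) *\<^sub>R x + t *\<^sub>R y \<in> realisation K"
proof -
  let ?S = "(\<lambda>v. axis v (1::real)) ` supp x"
  have "(1 - t) *\<^sub>R x + t *\<^sub>R y \<in> convex hull ?S"
    using x y t by (intro convexD[OF convex_convex_hull]) (auto simp: mem_simplex_iff mem_realisation_iff)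
  moreover have "supp x \<in> K"
    using x unfolding mem_realisation_iff by blast
  ultimately show ?thesis
    using realisation_triangulation(2)[OF K] by blast
qed

lemma axis_in_realisation:
  assumes "finite_complex K" "v \<in> \<Union>K"
  shows "axis v 1 \<in> realisation K"
proof -
  obtain A where "A \<in> K" "v \<in> A"
    using assms(2) by blast
  then have "{v} \<in> K"
    using finite_complex_subset[OF assms(1), of A "{v}"] by simp
  then show ?thesis
    by (simp add: mem_realisation_iff) (simp add: axis_def)
qed

lemma barycentre:
  fixes A :: "'v::finite set"
  assumes "finite_complex K" "A \<in> K"
  obtains x where "x \<in> realisation K" "supp x = A" "\<And>v. v \<in> A \<Longrightarrow> x $ v = 1 / card A"
proof
  let ?x = "(\<chi> v. if v \<in> A then 1 / card A else 0) :: real^'v"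
  have "A \<noteq> {}" "finite A"
    using assms unfolding finite_complex_def by auto
  then show supp: "supp ?x = A"
    by (auto simp: supp_def)
  show "?x \<in> realisation K"
    using \<open>A \<noteq> {}\<close> assms(2) unfolding mem_realisation_iff supp
    by (simp add: sum.If_cases)
qed simp

section \<open>Fibres of a non-degenerate simplicial map\<close>

lemma linear_realisation_map: "linear (realisation_map K f)"
  by (rule linearI)
     (auto simp: realisation_map_def vec_eq_iff sum.distrib sum_distrib_left)

locale nondegenerate_simplicial_map =
  fixes K :: "'v::finite set set" and L :: "'w::finite set set" and f :: "'v \<Rightarrow> 'w"
  assumes K: "finite_complex K"
    and simplicial: "simplicial_map K L f" and nondegenerate: "nondegenerate K f"
begin

abbreviation \<phi> :: "real^'v \<Rightarrow> real^'w" where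
  "\<phi> \<equiv> realisation_map K f"

abbreviation lifting :: "(real^'v \<Rightarrow> (real^'w) \<times> real) \<Rightarrow> bool" where
  "lifting \<equiv> is_lifting (realisation K) (realisation L) \<phi>"

lemma supp_subset_vertices: "x \<in> realisation K \<Longrightarrow> supp x \<subseteq> \<Union>K"
  unfolding mem_realisation_iff by blast

text \<open>As \<open>f\<close> is injective on the support of \<open>x\<close>, the sum that defines the coordinate of the image
  at \<open>f v\<close> has a single nonzero summand: the map only relabels coordinates.\<close>

lemma realisation_map_coordinate:
  assumes x: "x \<in> realisation K" and v: "v \<in> supp x"
  shows "\<phi> x $ f v = x $ v"
proof -
  have "inj_on f (supp x)"
    using x nondegenerate unfolding mem_realisation_iff nondegenerate_def by blast
  then have "x $ w = 0" if "f w = f v" "w \<noteq> v" for w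
    using that v unfolding supp_def by (auto dest: inj_onD)
  then have "(\<Sum>w | w \<in> \<Union>K \<and> f w = f v. x $ w) = (\<Sum>w\<in>{v}. x $ w)"
    using supp_subset_vertices[OF x] v by (intro sum.mono_neutral_right) auto
  then show ?thesis
    unfolding realisation_map_def by simp
qed

lemma supp_realisation_map:
  assumes x: "x \<in> realisation K"
  shows "supp (\<phi> x) = f ` supp x"
proof
  show "f ` supp x \<subseteq> supp (\<phi> x)"
    using realisation_map_coordinate[OF x] by (auto simp: supp_def)
  show "supp (\<phi> x) \<subseteq> f ` supp x"
  proof
    fix w assume "w \<in> supp (\<phi> x)"
    then have "(\<Sum>v | v \<in> \<Union>K \<and> f v = w. x $ v) \<noteq> 0"
      unfolding supp_def realisation_map_def by simp
    then obtain v where "f v = w" "x $ v \<noteq> 0"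
      by (metis (mono_tags, lifting) mem_Collect_eq sum.neutral)
    then show "w \<in> f ` supp x"
      by (auto simp: supp_def)
  qed
qed

lemma realisation_map_in_realisation:
  assumes x: "x \<in> realisation K"
  shows "\<phi> x \<in> realisation L"
proof -
  have "(\<Sum>w\<in>UNIV. \<phi> x $ w) = (\<Sum>w\<in>UNIV. \<Sum>v | v \<in> \<Union>K \<and> f v = w. x $ v)"
    unfolding realisation_map_def by simp
  also have "\<dots> = (\<Sum>v\<in>\<Union>K. x $ v)"
    by (rule sum.group) auto
  also have "\<dots> = (\<Sum>v\<in>UNIV. x $ v)"
    using supp_subset_vertices[OF x] by (intro sum.mono_neutral_left) (auto simp: supp_def)
  finally have "(\<Sum>w\<in>UNIV. \<phi> x $ w) = 1"
    using x unfolding mem_realisation_iff by simp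
  moreover have "0 \<le> \<phi> x $ w" for w
    using x unfolding realisation_map_def mem_realisation_iff by (simp add: sum_nonneg)
  moreover have "supp (\<phi> x) \<in> L"
    using x simplicial unfolding supp_realisation_map[OF x] mem_realisation_iff simplicial_map_def by blast
  ultimately show ?thesis
    unfolding mem_realisation_iff by blast
qed

lemma realisation_map_axis: "v \<in> \<Union>K \<Longrightarrow> \<phi> (axis v 1) = axis (f v) 1"
proof -
  assume v: "v \<in> \<Union>K"
  have "(\<Sum>u | u \<in> \<Union>K \<and> f u = w. axis v (1::real) $ u) = (if f v = w then 1 else 0)" for w
    using v unfolding axis_def by (simp add: sum.If_cases Int_def)
  then show ?thesis
    unfolding realisation_map_def by (simp add: vec_eq_iff axis_def)
qed

lemma matching_vertices:
  assumes xy: "x \<in> realisation K" "y \<in> realisation K" "\<phi> x = \<phi> y" and v: "v \<in> supp x"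
  obtains w where "w \<in> supp y" "f w = f v" "x $ v = y $ w"
proof -
  have "f v \<in> f ` supp y"
    using xy v supp_realisation_map by (metis imageI)
  then obtain w where "w \<in> supp y" "f w = f v"
    by auto
  then show thesis
    using that xy v realisation_map_coordinate by metis
qed

text \<open>A point can be recovered from its image and its support, as its coordinates on the support
  are those of the image.\<close>

lemma equal_if_matching_vertices_equal:
  assumes xy: "x \<in> realisation K" "y \<in> realisation K" "\<phi> x = \<phi> y"
    and eq: "\<And>v w. v \<in> supp x \<Longrightarrow> w \<in> supp y \<Longrightarrow> f v = f w \<Longrightarrow> v = w"
  shows "x = y"
proof -
  have "x $ v = y $ v" for v
  proof (cases "v \<in> supp x")
    case True
    then show ?thesis
      using matching_vertices[OF xy True] eq by metis
  next
    case False
    have "v \<notin> supp y"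
    proof
      assume "v \<in> supp y"
      then obtain w where "w \<in> supp x" "f w = f v"
        using matching_vertices xy by metis
      then show False
        using eq[of w v] False \<open>v \<in> supp y\<close> by simp
    qed
    then show ?thesis
      using False by (simp add: supp_def)
  qed
  then show ?thesis
    by (simp add: vec_eq_iff)
qed

section \<open>The vertex orders of a lifting\<close>

definition height :: "(real^'v \<Rightarrow> (real^'w) \<times> real) \<Rightarrow> 'v \<Rightarrow> real" where
  "height g v = snd (g (axis v 1))"

text \<open>Move \<open>x\<close> straight to the vertex \<open>v\<close> and \<open>y\<close> straight to the vertex \<open>w\<close>. The images remain
  equal, and the points remain distinct because the coordinate at \<open>v\<close> of the first is always
  positive, whereas that of the second is zero: \<open>v\<close> is not in the support of \<open>y\<close>, on which \<open>f\<close> is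
  injective and which contains \<open>w\<close>. So the order of the heights at the start is that at the
  end.\<close>

lemma lifting_order_by_vertices:
  assumes g: "lifting g" and xy: "x \<in> realisation K" "y \<in> realisation K" "\<phi> x = \<phi> y"
    and vw: "v \<in> supp x" "w \<in> supp y" "f v = f w" "v \<noteq> w"
  shows "snd (g x) < snd (g y) \<longleftrightarrow> height g v < height g w"
proof -
  define p where "p = (\<lambda>t::real. (1 - t) *\<^sub>R x + t *\<^sub>R axis v 1)"
  define q where "q = (\<lambda>t::real. (1 - t) *\<^sub>R y + t *\<^sub>R axis w 1)"
  have vert: "v \<in> \<Union>K" "w \<in> \<Union>K"
    using xy vw supp_subset_vertices by blast+
  have yv: "y $ v = 0"
  proof -
    have "inj_on f (supp y)"
      using xy nondegenerate unfolding mem_realisation_iff nondegenerate_def by blast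
    then show ?thesis
      using vw unfolding supp_def by (auto dest: inj_onD)
  qed
  have "x $ v > 0"
    using xy(1) vw(1) unfolding mem_realisation_iff supp_def by (auto simp: less_le)
  have "snd (g (p 0)) < snd (g (q 0)) \<longleftrightarrow> snd (g (p 1)) < snd (g (q 1))"
  proof (rule lifting_order_constant_along_paths[OF g])
    show "continuous_on {0..1} p" "continuous_on {0..1} q"
      unfolding p_def q_def by (intro continuous_intros)+
    fix t :: real assume t: "t \<in> {0..1}"
    have "p t \<in> realisation K" "q t \<in> realisation K"
      unfolding p_def q_def using xy vw t K
      by (auto intro!: realisation_segment) (auto simp: axis_def)
    moreover have "\<phi> (p t) = \<phi> (q t)"
      unfolding p_def q_def using xy(3) vw(3) vert
      by (simp add: linear_add[OF linear_realisation_map] linear_scale[OF linear_realisation_map]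
          realisation_map_axis)
    moreover have "p t $ v > 0"
      using t \<open>x $ v > 0\<close> unfolding p_def by (cases "t = 0") (auto simp: axis_def intro!: add_nonneg_pos)
    moreover have "q t $ v = 0"
      using yv vw(4) unfolding q_def by (simp add: axis_def)
    ultimately show "p t \<in> realisation K \<and> q t \<in> realisation K \<and> \<phi> (p t) = \<phi> (q t) \<and> p t \<noteq> q t"
      by auto
  qed
  then show ?thesis
    unfolding p_def q_def height_def by simp
qed

definition vertex_orders :: "(real^'v \<Rightarrow> (real^'w) \<times> real) \<Rightarrow> 'w \<Rightarrow> 'v rel" where
  "vertex_orders g = (\<lambda>u\<in>\<Union>L. {(v, w). v \<in> vertices_over K f u \<and> w \<in> vertices_over K f u \<and>
      height g v < height g w})"

lemma vertex_image_in_L: "v \<in> \<Union>K \<Longrightarrow> f v \<in> \<Union>L"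
  using simplicial unfolding simplicial_map_def by blast

lemma mem_vertex_orders_iff:
  assumes "v \<in> \<Union>K" "w \<in> \<Union>K" "f v = f w"
  shows "(v, w) \<in> vertex_orders g (f v) \<longleftrightarrow> height g v < height g w"
  using assms vertex_image_in_L[of v] unfolding vertex_orders_def vertices_over_def by auto

lemma height_distinct:
  assumes "lifting g" "v \<in> \<Union>K" "w \<in> \<Union>K" "f v = f w" "v \<noteq> w"
  shows "height g v \<noteq> height g w"
  unfolding height_def
  by (rule lifting_heights_distinct[OF assms(1)])
     (use assms(2-5) axis_in_realisation[OF K] in \<open>simp_all add: realisation_map_axis axis_eq_axis\<close>)

text \<open>Admissibility compares two simplices over \<open>C\<close>; their barycentres have the same image, and
  by the previous comparison the order of their heights is that of all pairs of distinct
  vertices.\<close>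

lemma admissible_vertex_orders:
  assumes g: "lifting g"
  shows "admissible K L f (vertex_orders g)"
  unfolding admissible_def
proof (intro conjI ballI)
  have "strict_linear_order_on (vertices_over K f u) {(v, w). v \<in> vertices_over K f u \<and>
      w \<in> vertices_over K f u \<and> height g v < height g w}" (is "strict_linear_order_on ?V ?r") for u
    unfolding strict_linear_order_on_def
  proof (intro conjI)
    show "trans ?r" "irrefl ?r"
      by (auto simp: trans_def irrefl_def)
    have "height g v < height g w \<or> height g w < height g v" if "v \<in> ?V" "w \<in> ?V" "v \<noteq> w" for v w
      using height_distinct[OF g, of v w] that unfolding vertices_over_def by force
    then show "total_on ?V ?r"
      unfolding total_on_def by blast
  qed
  then show "vertex_orders g \<in> order_collections K L f"
    unfolding order_collections_def vertex_orders_def by auto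
next
  fix C A B assume "A \<in> simplices_over K f C" "B \<in> simplices_over K f C"
  then have AB: "A \<in> K" "B \<in> K" "f ` A = C" "f ` B = C"
    unfolding simplices_over_def by auto
  obtain x where x: "x \<in> realisation K" "supp x = A" "\<And>v. v \<in> A \<Longrightarrow> x $ v = 1 / card A"
    using barycentre[OF K AB(1)] by metis
  obtain y where y: "y \<in> realisation K" "supp y = B" "\<And>v. v \<in> B \<Longrightarrow> y $ v = 1 / card B"
    using barycentre[OF K AB(2)] by metis
  have "card A = card B"
    using AB nondegenerate unfolding nondegenerate_def by (metis card_image)
  have "\<phi> x = \<phi> y"
  proof -
    have supp: "supp (\<phi> x) = C" "supp (\<phi> y) = C"
      using supp_realisation_map x(1,2) y(1,2) AB by auto
    have "\<phi> x $ u = \<phi> y $ u" for u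
    proof (cases "u \<in> C")
      case True
      then obtain v w where vw: "v \<in> A" "f v = u" "w \<in> B" "f w = u"
        using AB(3,4) by (metis imageE)
      have "\<phi> x $ f v = 1 / card A"
        using realisation_map_coordinate[OF x(1), of v] x(2,3) vw(1) by simp
      moreover have "\<phi> y $ f w = 1 / card B"
        using realisation_map_coordinate[OF y(1), of w] y(2,3) vw(3) by simp
      ultimately show ?thesis
        using vw \<open>card A = card B\<close> by simp
    next
      case False
      then have "u \<notin> supp (\<phi> x)" "u \<notin> supp (\<phi> y)"
        using supp by simp_all
      then show ?thesis
        by (simp add: supp_def)
    qed
    then show ?thesis
      by (simp add: vec_eq_iff)
  qed
  have iff: "(v, w) \<in> vertex_orders g (f v) \<longleftrightarrow> snd (g x) < snd (g y)"
    and total: "(v, w) \<in> vertex_orders g (f v) \<or> (w, v) \<in> vertex_orders g (f v)"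
    if "(v, w) \<in> vertex_pairs f A B" "v \<noteq> w" for v w
  proof -
    have *: "v \<in> supp x" "w \<in> supp y" "f v = f w" "v \<in> \<Union>K" "w \<in> \<Union>K"
      using that AB x y unfolding vertex_pairs_def by auto
    show "(v, w) \<in> vertex_orders g (f v) \<longleftrightarrow> snd (g x) < snd (g y)"
      using lifting_order_by_vertices[OF g x(1) y(1) \<open>\<phi> x = \<phi> y\<close> *(1-3) that(2)]
        mem_vertex_orders_iff * by simp
    show "(v, w) \<in> vertex_orders g (f v) \<or> (w, v) \<in> vertex_orders g (f v)"
      using height_distinct[OF g *(4,5,3) that(2)] mem_vertex_orders_iff[of v w]
        mem_vertex_orders_iff[of w v] * by fastforce
  qed
  show "(\<forall>(v, w)\<in>vertex_pairs f A B. v = w \<or> (v, w) \<in> vertex_orders g (f v)) \<or>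
        (\<forall>(v, w)\<in>vertex_pairs f A B. v = w \<or> (w, v) \<in> vertex_orders g (f v))"
    using iff total by (cases "snd (g x) < snd (g y)") blast+
qed

text \<open>In one direction, isotopies keep the order of the vertices themselves. In the other, points of
  the same fibre that differ have distinct matching vertices, and the order of these, common to
  both liftings, is the order of the points.\<close>

lemma isotopic_iff_same_vertex_orders:
  "isotopic_liftings (realisation K) (realisation L) \<phi> g h \<longleftrightarrow>
     lifting g \<and> lifting h \<and> vertex_orders g = vertex_orders h"
proof
  assume iso: "isotopic_liftings (realisation K) (realisation L) \<phi> g h"
  then have "lifting g" "lifting h"
    unfolding isotopic_liftings_def using homotopic_with_imp_property by blast+
  moreover have "height g v < height g w \<longleftrightarrow> height h v < height h w"
    if "v \<in> vertices_over K f u" "w \<in> vertices_over K f u" for u v w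
  proof (cases "v = w")
    case False
    then show ?thesis
      using that isotopic_liftings_imp_same_order[OF iso, of "axis v 1" "axis w 1"]
        axis_in_realisation[OF K]
      unfolding height_def vertices_over_def by (auto simp: realisation_map_axis axis_eq_axis)
  qed simp
  then have "vertex_orders g = vertex_orders h"
    unfolding vertex_orders_def by (intro restrict_ext) blast
  ultimately show "lifting g \<and> lifting h \<and> vertex_orders g = vertex_orders h"
    by blast
next
  assume *: "lifting g \<and> lifting h \<and> vertex_orders g = vertex_orders h"
  show "isotopic_liftings (realisation K) (realisation L) \<phi> g h"
  proof (rule isotopic_liftings_if_same_order)
    fix x y assume xy: "x \<in> realisation K" "y \<in> realisation K" "\<phi> x = \<phi> y"
    show "snd (g x) < snd (g y) \<longleftrightarrow> snd (h x) < snd (h y)"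
    proof (cases "x = y")
      case False
      then obtain v w where vw: "v \<in> supp x" "w \<in> supp y" "f v = f w" "v \<noteq> w"
        using equal_if_matching_vertices_equal[OF xy] by metis
      then have "v \<in> \<Union>K" "w \<in> \<Union>K"
        using xy supp_subset_vertices by blast+
      then show ?thesis
        using lifting_order_by_vertices[OF _ xy vw] * mem_vertex_orders_iff[OF _ _ vw(3)] by metis
    qed simp
  qed (use * in auto)
qed

section \<open>The lifting of an admissible collection\<close>

definition rank :: "('w \<Rightarrow> 'v rel) \<Rightarrow> 'v \<Rightarrow> real" where
  "rank R v = card {w. (w, v) \<in> R (f v)}"

definition linear_lifting :: "('v \<Rightarrow> real) \<Rightarrow> real^'v \<Rightarrow> (real^'w) \<times> real" where
  "linear_lifting r x = (\<phi> x, \<Sum>v\<in>UNIV. r v * x $ v)"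

lemma height_linear_lifting [simp]: "height (linear_lifting r) = r"
  unfolding height_def linear_lifting_def axis_def by (auto simp: if_distrib cong: if_cong)

text \<open>Over a point of the interior of \<open>C\<close>, the difference of the heights of two preimages in the
  interiors of \<open>A\<close> and \<open>B\<close> is the sum of the differences of the heights of matching vertices,
  weighted by the common barycentric coordinates. If no summand is negative, the sum vanishes only
  if every pair of matching vertices is a single vertex.\<close>

lemma linear_lifting_eq_imp_eq:
  assumes xy: "x \<in> realisation K" "y \<in> realisation K" "linear_lifting r x = linear_lifting r y"
    and le: "\<And>v w. (v, w) \<in> vertex_pairs f (supp x) (supp y) \<Longrightarrow> v = w \<or> r v < r w"
  shows "x = y"
proof -
  have \<phi>: "\<phi> x = \<phi> y" and sums: "(\<Sum>v\<in>UNIV. r v * x $ v) = (\<Sum>v\<in>UNIV. r v * y $ v)"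
    using xy(3) unfolding linear_lifting_def by auto
  have inj: "inj_on f (supp x)" "inj_on f (supp y)"
    using xy nondegenerate unfolding mem_realisation_iff nondegenerate_def by blast+
  have im: "f ` supp x = f ` supp y"
    using xy \<phi> supp_realisation_map by metis
  (* m sends a vertex of the carrier of x to the matching vertex of the carrier of y. *)
  define m where "m = the_inv_into (supp y) f \<circ> f"
  have bij: "bij_betw m (supp x) (supp y)"
    unfolding m_def
    by (rule bij_betw_trans[of f _ "f ` supp y"])
       (use inj im in \<open>auto simp: bij_betw_def inj_on_the_inv_into the_inv_into_onto\<close>)
  have m: "m v \<in> supp y" "f (m v) = f v" if "v \<in> supp x" for v
    using that im inj(2) unfolding m_def
    by (auto intro!: the_inv_into_into f_the_inv_into_f)
  have xm: "y $ m v = x $ v" if "v \<in> supp x" for v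
    using realisation_map_coordinate[OF xy(1) that] realisation_map_coordinate[OF xy(2) m(1)[OF that]]
      m(2)[OF that] \<phi> by simp
  have le': "v = m v \<or> r v < r (m v)" if "v \<in> supp x" for v
    using le[of v "m v"] m[OF that] that unfolding vertex_pairs_def by auto
  have pos: "x $ v > 0" if "v \<in> supp x" for v
    using xy(1) that unfolding mem_realisation_iff supp_def by (auto simp: less_le)
  have restrict: "(\<Sum>v\<in>UNIV. r v * z $ v) = (\<Sum>v\<in>supp z. r v * z $ v)" for z
    by (intro sum.mono_neutral_right) (auto simp: supp_def)
  have "(\<Sum>v\<in>supp y. r v * y $ v) = (\<Sum>v\<in>supp x. r (m v) * y $ m v)"
    using sum.reindex_bij_betw[OF bij, of "\<lambda>v. r v * y $ v"] by simp
  also have "\<dots> = (\<Sum>v\<in>supp x. r (m v) * x $ v)"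
    using xm by (intro sum.cong) auto
  finally have "(\<Sum>v\<in>supp x. (r (m v) - r v) * x $ v) = 0"
    using sums unfolding restrict by (simp add: left_diff_distrib sum_subtractf)
  moreover have "0 \<le> (r (m v) - r v) * x $ v" if "v \<in> supp x" for v
    using le'[OF that] pos[OF that] by (auto intro!: mult_nonneg_nonneg)
  ultimately have "(r (m v) - r v) * x $ v = 0" if "v \<in> supp x" for v
    using that by (subst (asm) sum_nonneg_eq_0_iff) auto
  then have eq: "m v = v" if "v \<in> supp x" for v
    using le'[OF that] pos[OF that] that by fastforce
  show ?thesis
  proof (rule equal_if_matching_vertices_equal[OF xy(1,2) \<phi>])
    show "v = w" if "v \<in> supp x" "w \<in> supp y" "f v = f w" for v w
      using that m[of v] eq[of v] inj(2) by (auto dest: inj_onD)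
  qed
qed

lemma lifting_linear_lifting:
  assumes le: "\<And>A B. A \<in> K \<Longrightarrow> B \<in> K \<Longrightarrow> f ` A = f ` B \<Longrightarrow>
      (\<forall>(v, w)\<in>vertex_pairs f A B. v = w \<or> r v < r w) \<or>
      (\<forall>(v, w)\<in>vertex_pairs f A B. v = w \<or> r w < r v)"
  shows "lifting (linear_lifting r)"
proof -
  have lin: "linear (linear_lifting r)"
    by (rule linearI)
       (simp_all add: linear_lifting_def linear_add[OF linear_realisation_map]
          linear_scale[OF linear_realisation_map] distrib_left sum.distrib sum_distrib_left mult.left_commute)
  then have "affine_map_on S (linear_lifting r)" for S
    unfolding affine_map_on_def by (metis add.right_neutral)
  moreover have "linear_lifting r ` realisation K \<subseteq> realisation L \<times> UNIV"
    using realisation_map_in_realisation unfolding linear_lifting_def by auto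
  ultimately have "pl_map (realisation K) (realisation L \<times> UNIV) (linear_lifting r)"
    using realisation_triangulation[OF K] unfolding pl_map_def by blast
  moreover have "continuous_on (realisation K) (linear_lifting r)"
    using lin by (simp add: linear_continuous_on linear_conv_bounded_linear)
  moreover have "inj_on (linear_lifting r) (realisation K)"
  proof (rule inj_onI)
    fix x y assume xy: "x \<in> realisation K" "y \<in> realisation K" "linear_lifting r x = linear_lifting r y"
    then have "f ` supp x = f ` supp y"
      unfolding linear_lifting_def using supp_realisation_map by (metis prod.inject)
    moreover have "supp x \<in> K" "supp y \<in> K"
      using xy unfolding mem_realisation_iff by blast+
    ultimately have "(\<forall>(v, w)\<in>vertex_pairs f (supp x) (supp y). v = w \<or> r v < r w) \<or>
        (\<forall>(v, w)\<in>vertex_pairs f (supp x) (supp y). v = w \<or> r w < r v)"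
      by (intro le)
    then show "x = y"
    proof
      assume *: "\<forall>(v, w)\<in>vertex_pairs f (supp x) (supp y). v = w \<or> r v < r w"
      have "v = w \<or> r v < r w" if "(v, w) \<in> vertex_pairs f (supp x) (supp y)" for v w
        using bspec[OF * that] by simp
      then show ?thesis
        by (rule linear_lifting_eq_imp_eq[OF xy])
    next
      assume *: "\<forall>(v, w)\<in>vertex_pairs f (supp x) (supp y). v = w \<or> r w < r v"
      have "v = w \<or> r v < r w" if "(v, w) \<in> vertex_pairs f (supp y) (supp x)" for v w
        using bspec[OF *, of "(w, v)"] that unfolding vertex_pairs_def by simp metis
      then have "y = x"
        by (rule linear_lifting_eq_imp_eq[OF xy(2,1) xy(3)[symmetric]])
      then show ?thesis ..
    qed
  qed
  ultimately show ?thesis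
    unfolding is_lifting_iff by (simp add: linear_lifting_def)
qed

text \<open>By transitivity the predecessors of a smaller vertex are among those of a larger one, and
  by irreflexivity the inclusion is strict.\<close>

lemma rank_less_iff:
  assumes R: "R \<in> order_collections K L f" and vw: "v \<in> \<Union>K" "w \<in> \<Union>K" "f v = f w"
  shows "rank R v < rank R w \<longleftrightarrow> (v, w) \<in> R (f v)"
proof -
  have "f v \<in> \<Union>L"
    using vertex_image_in_L vw by blast
  then have "strict_linear_order_on (vertices_over K f (f v)) (R (f v))"
    using R unfolding order_collections_def by auto
  then have order: "trans (R (f v))" "irrefl (R (f v))" "total_on (vertices_over K f (f v)) (R (f v))"
    unfolding strict_linear_order_on_def by auto
  have less: "rank R a < rank R b" if ab: "(a, b) \<in> R (f v)" "f a = f v" "f b = f v" for a b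
  proof -
    have "{u. (u, a) \<in> R (f v)} \<subset> {u. (u, b) \<in> R (f v)}"
      using ab order(1,2) by (auto simp: irrefl_def dest: transD)
    then show ?thesis
      unfolding rank_def using ab by (simp add: psubset_card_mono)
  qed
  show ?thesis
  proof
    assume "rank R v < rank R w"
    moreover have "v = w \<or> (v, w) \<in> R (f v) \<or> (w, v) \<in> R (f v)"
      using order(3) vw unfolding total_on_def vertices_over_def by auto
    ultimately show "(v, w) \<in> R (f v)"
      using less[of w v] vw(3) by (metis order_less_asym order_less_irrefl)
  qed (use less vw in auto)
qed

lemma lifting_of_admissible:
  assumes R: "admissible K L f R"
  shows "lifting (linear_lifting (rank R))" "vertex_orders (linear_lifting (rank R)) = R"
proof -
  have RO: "R \<in> order_collections K L f"
    using R unfolding admissible_def by blast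
  show "lifting (linear_lifting (rank R))"
  proof (rule lifting_linear_lifting)
    fix A B assume AB: "A \<in> K" "B \<in> K" "f ` A = f ` B"
    have rank: "rank R v < rank R w \<longleftrightarrow> (v, w) \<in> R (f v)" "rank R w < rank R v \<longleftrightarrow> (w, v) \<in> R (f v)"
      if "(v, w) \<in> vertex_pairs f A B" for v w
    proof -
      have "v \<in> \<Union>K" "w \<in> \<Union>K" "f v = f w"
        using that AB unfolding vertex_pairs_def by auto
      then show "rank R v < rank R w \<longleftrightarrow> (v, w) \<in> R (f v)" "rank R w < rank R v \<longleftrightarrow> (w, v) \<in> R (f v)"
        using rank_less_iff[OF RO, of v w] rank_less_iff[OF RO, of w v] by auto
    qed
    have "f ` A \<in> L"
      using AB simplicial unfolding simplicial_map_def by blast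
    then have "(\<forall>(v, w)\<in>vertex_pairs f A B. v = w \<or> (v, w) \<in> R (f v)) \<or>
        (\<forall>(v, w)\<in>vertex_pairs f A B. v = w \<or> (w, v) \<in> R (f v))"
      using R AB unfolding admissible_def simplices_over_def
      by (elim conjE, elim ballE[where x = "f ` A"] ballE[where x = A] ballE[where x = B]) auto
    then show "(\<forall>(v, w)\<in>vertex_pairs f A B. v = w \<or> rank R v < rank R w) \<or>
        (\<forall>(v, w)\<in>vertex_pairs f A B. v = w \<or> rank R w < rank R v)"
    proof (rule disj_forward)
      show "\<forall>(v, w)\<in>vertex_pairs f A B. v = w \<or> rank R v < rank R w"
        if "\<forall>(v, w)\<in>vertex_pairs f A B. v = w \<or> (v, w) \<in> R (f v)"
        using that rank(1) by fast
      show "\<forall>(v, w)\<in>vertex_pairs f A B. v = w \<or> rank R w < rank R v"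
        if "\<forall>(v, w)\<in>vertex_pairs f A B. v = w \<or> (w, v) \<in> R (f v)"
        using that rank(2) by fast
    qed
  qed
  show "vertex_orders (linear_lifting (rank R)) = R"
  proof
    fix u
    show "vertex_orders (linear_lifting (rank R)) u = R u"
    proof (cases "u \<in> \<Union>L")
      case True
      then have sub: "R u \<subseteq> vertices_over K f u \<times> vertices_over K f u"
        using PiE_mem[OF RO[unfolded order_collections_def]] by blast
      have "(v, w) \<in> vertex_orders (linear_lifting (rank R)) u \<longleftrightarrow> (v, w) \<in> R u"
        if "v \<in> vertices_over K f u" "w \<in> vertices_over K f u" for v w
        using that mem_vertex_orders_iff[of v w] rank_less_iff[OF RO, of v w]
        unfolding vertices_over_def by force
      moreover have "vertex_orders (linear_lifting (rank R)) u
          \<subseteq> vertices_over K f u \<times> vertices_over K f u"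
        using True unfolding vertex_orders_def by auto
      ultimately show ?thesis
        using sub by (intro subset_antisym subrelI) blast+
    next
      case False
      then show ?thesis
        using PiE_arb[OF RO[unfolded order_collections_def]] unfolding vertex_orders_def by simp
    qed
  qed
qed

end

section \<open>The classification of liftings\<close>

text \<open>The classes of the relation of having the same value under \<open>k\<close> are the fibres of \<open>k\<close>.\<close>

lemma bij_betw_fibres_quotient:
  assumes "\<And>x y. (x, y) \<in> E \<longleftrightarrow> x \<in> X \<and> y \<in> X \<and> k x = k y" and "k ` X = Y"
  shows "bij_betw (\<lambda>y. {x \<in> X. k x = y}) Y (X // E)"
proof -
  have "E `` {x} = {x' \<in> X. k x' = k x}" if "x \<in> X" for x
    using that assms(1) by auto
  then have "X // E = (\<lambda>y. {x \<in> X. k x = y}) ` Y"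
    unfolding quotient_def assms(2)[symmetric] by auto
  moreover have "inj_on (\<lambda>y. {x \<in> X. k x = y}) Y"
    unfolding assms(2)[symmetric] by (rule inj_onI) blast
  ultimately show ?thesis
    unfolding bij_betw_def by simp
qed

theorem theorem2:
  fixes K :: "'v::finite set set" and L :: "'w::finite set set" and f :: "'v \<Rightarrow> 'w"
  assumes "finite_complex K" and "finite_complex L"
    and "simplicial_map K L f" and "nondegenerate K f"
  shows "(lifts_to_embedding (realisation K) (realisation L) (realisation_map K f)
            \<longleftrightarrow> (\<exists>R. admissible K L f R)) \<and>
         (\<exists>\<Phi>. bij_betw \<Phi> {R. admissible K L f R}
            (isotopy_classes (realisation K) (realisation L) (realisation_map K f)))"
proof -
  interpret nondegenerate_simplicial_map K L f
    using assms by unfold_locales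
  have image: "vertex_orders ` {g. lifting g} = {R. admissible K L f R}"
    using admissible_vertex_orders lifting_of_admissible by force
  then have "lifts_to_embedding (realisation K) (realisation L) \<phi> \<longleftrightarrow> (\<exists>R. admissible K L f R)"
    unfolding lifts_to_embedding_def by blast
  moreover have "bij_betw (\<lambda>R. {g \<in> {g. lifting g}. vertex_orders g = R}) {R. admissible K L f R}
      (isotopy_classes (realisation K) (realisation L) \<phi>)"
    unfolding isotopy_classes_def
    by (rule bij_betw_fibres_quotient) (auto simp: isotopic_iff_same_vertex_orders image)
  ultimately show ?thesis
    by blast
qed

end
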